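(* Let $m=ad$ and $n=bd$, where $a,b,d$ are positive integers with $\gcd(a,b)=1$ and $a$ odd. Then we have the factorization $$ T_n(x)-T_m(y) = 2^{d-1} \prod_{k=0}^{\lfloor d/2\rfloor} C_k(x,y),\qquad C_k(x,y)=E_{\frac{2ak\pi}{d}}\bigl(T_b(x),T_a(y)\bigr), $$ where, for each $k$, $C_k(x,y)=0$ is the irreducible equation of the curve $\mathcal{C}_k: x=\cos(at),\ y=\cos\bigl(bt+\frac{2k\pi}{d}\bigr)$, $t\in\mathbb{C}$.
   Context: $T_n$ denotes the Chebyshev polynomial of the first kind: $T_0=1$, $T_1=t$, $T_{n+1}=2tT_n-T_{n-1}$, so that $T_n(\cos\theta)=\cos n\theta$. For real $\mu\not\equiv 0 \pmod \pi$, set $E_{\mu}(x,y)=x^2+y^2-2\cos(\mu)xy-\sin^2(\mu)$; moreover $E_0(x,y)=x-y$ and $E_\pi(x,y)=x+y$, the index $\mu$ being understood modulo $2\pi$. For $a,b$ coprime with $a$ odd and $\phi$ real, the parametric curve $x=\cos(at),\ y=\cos(bt+\phi)$, $t\in\mathbb{C}$, has the equation $E_{a\phi}(T_b(x),T_a(y))=0$.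
   Formalization: The factorization with index 2akπ/d is stated only for gcd(a,d)=1, as it fails otherwise (e.g. a=d=3, b=1, where factors repeat); for all a,b,d it is given with index 2kπ/d, each factor being the irreducible equation of x=cos(at), y=cos(bt+2kπ/(ad)). *)

theory Defs
  imports
    "HOL-Computational_Algebra.Computational_Algebra"
    "HOL-Library.Real_Mod"
    Complex_Main
begin

fun cheb :: "nat \<Rightarrow> 'a::comm_ring_1 poly" where
  "cheb 0 = 1"
| "cheb (Suc 0) = [:0, 1:]"
| "cheb (Suc (Suc n)) = [:0, 2:] * cheb (Suc n) - cheb n"

text \<open>
  The ring of polynomials in two variables $x$, $y$ over the complex numbers is
  \<^typ>\<open>complex poly poly\<close>, with $x$ the inner and $y$ the outer variable.
  Since \<^const>\<open>cheb\<close> has coefficients in an arbitrary commutative ring, the polynomial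
  $T_n(p)$ for a bivariate polynomial $p$ is \<open>poly (cheb n) p\<close>.
\<close>

definition varX :: "complex poly poly" where
  "varX = [:[:0, 1:]:]"

definition varY :: "complex poly poly" where
  "varY = [:0, 1:]"

definition const2 :: "complex \<Rightarrow> complex poly poly" where
  "const2 c = [:[:c:]:]"

definition eval2 :: "complex poly poly \<Rightarrow> complex \<Rightarrow> complex \<Rightarrow> complex" where
  "eval2 P x y = poly (poly P [:y:]) x"

definition E :: "real \<Rightarrow> complex poly poly \<Rightarrow> complex poly poly \<Rightarrow> complex poly poly" where
  "E \<mu> p q =
     (if [\<mu> = 0] (rmod (2 * pi)) then p - q
      else if [\<mu> = pi] (rmod (2 * pi)) then p + q
      else p\<^sup>2 + q\<^sup>2 - const2 (of_real (2 * cos \<mu>)) * p * q - const2 (of_real ((sin \<mu>)\<^sup>2)))"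

definition curve :: "nat \<Rightarrow> nat \<Rightarrow> real \<Rightarrow> (complex \<times> complex) set" where
  "curve a b \<phi> =
     {(cos (of_nat a * t), cos (of_nat b * t + of_real \<phi>)) | t :: complex. True}"

text \<open>
  \<^const>\<open>irreducible\<close> here is irreducibility in the ring of bivariate polynomials over the
  complex numbers, which implies irreducibility over the reals.
\<close>

definition irreducible_equation_of :: "complex poly poly \<Rightarrow> (complex \<times> complex) set \<Rightarrow> bool" where
  "irreducible_equation_of P S \<longleftrightarrow> irreducible P \<and> {(x, y). eval2 P x y = 0} = S"

text \<open>
  The factorization of $T_{bd}(x) - T_{ad}(y)$ into the factors with index $2ak\pi/d$ needs
  $\gcd(a,d) = 1$; without it, factors are repeated and others are missing. The case
  $a = d = 3$, $b = 1$ is a counterexample, where both factors are $T_1(x) - T_3(y)$.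
\<close>

lemma factorization_fails_if_not_coprime:
  "poly (cheb (1 * 3)) varX - poly (cheb (3 * 3)) varY
     \<noteq> 2 ^ (3 - 1) * (\<Prod>k = 0..3 div 2.
          E (2 * real 3 * real k * pi / real 3) (poly (cheb 1) varX) (poly (cheb 3) varY))"
    (is "?L \<noteq> ?R")
proof
  assume eq: "?L = ?R"
  have c0: "[2 * real 3 * real k * pi / real 3 = 0] (rmod (2 * pi))" for k
    by (rule rcong_sym, unfold rcong_altdef, rule exI[of _ "int k"]) simp
  have L: "eval2 ?L 1 0 = 1"
    by (simp add: eval2_def varX_def varY_def numeral_eq_Suc)
  have R: "eval2 ?R 1 0 = 4"
    unfolding E_def if_P[OF c0]
    by (simp add: eval2_def varX_def varY_def numeral_eq_Suc)
  from eq L R show False by simp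
qed

end

theory Submission
  imports
    Defs
    "HOL-Complex_Analysis.Conformal_Mappings"
    "HOL-Number_Theory.Cong"
begin

text \<open>
  Substituting $x = \cos u$ and $y = \cos v$ turns $E_\mu(T_b(x), T_a(y))$ into
  $(\cos av - \cos(bu + \mu))(\cos av - \cos(bu - \mu))$. Its zero set is read off from this, with
  Bezout's identity for $a$ and $b$ supplying the parameter $t$. The factorization is the product
  $\cos d\alpha - \cos d\beta = 2^{d-1} \prod_{k<d} (\cos\alpha - \cos(\beta + 2ck\pi/d))$,
  in which the factors $k$ and $d - k$ combine to $E_{2ck\pi/d}$.

  For irreducibility, one factor of $E_{a\phi}(T_b(x), T_a(y))$ vanishes on the whole curve, because the
  curve is parametrized by entire functions. Above $x = \cos \mathrm{i}$ the curve has as many points as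
  the degree of $E_{a\phi}(T_b(x), T_a(y))$ in $y$, so this factor has full degree in $y$; since the leading
  coefficient in $y$ is constant, the cofactor is a constant.
\<close>

section \<open>Evaluation of bivariate polynomials, and Chebyshev polynomials\<close>

lemma eval2_simps [simp]:
  "eval2 (P + Q) x y = eval2 P x y + eval2 Q x y"
  "eval2 (P - Q) x y = eval2 P x y - eval2 Q x y"
  "eval2 (P * Q) x y = eval2 P x y * eval2 Q x y"
  "eval2 0 x y = 0"
  "eval2 1 x y = 1"
  "eval2 (numeral w) x y = numeral w"
  "eval2 (P ^ n) x y = eval2 P x y ^ n"
  "eval2 varX x y = x"
  "eval2 varY x y = y"
  "eval2 (const2 c) x y = c"
  "eval2 (smult c' P) x y = poly c' x * eval2 P x y"
  by (simp_all add: eval2_def varX_def varY_def const2_def numeral_poly)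

lemma eval2_prod [simp]: "eval2 (\<Prod>i\<in>A. f i) x y = (\<Prod>i\<in>A. eval2 (f i) x y)"
  by (induction A rule: infinite_finite_induct) simp_all

lemma eval2_cheb [simp]: "eval2 (poly (cheb n) p) x y = poly (cheb n) (eval2 p x y)"
proof (induction n rule: cheb.induct)
  case (3 n)
  then show ?case by (simp add: algebra_simps numeral_poly)
qed simp_all

text \<open>For each y, the polynomial \<open>poly (P - Q) [:y:]\<close> in x vanishes everywhere
  and is therefore 0. So \<open>P - Q\<close> has infinitely many roots in its coefficient ring,
  namely all constants \<open>[:y:]\<close>, which is impossible unless it is 0.\<close>

lemma eval2_eqI:
  assumes "\<And>x y. eval2 P x y = eval2 Q x y"
  shows "P = Q"
proof (rule ccontr)
  assume "P \<noteq> Q"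
  then have "finite {c. poly (P - Q) c = 0}"
    by (intro poly_roots_finite) simp
  moreover have "range (\<lambda>y. [:y:]) \<subseteq> {c. poly (P - Q) c = 0}"
    using assms by (auto simp: eval2_def poly_eq_poly_eq_iff[symmetric] fun_eq_iff)
  moreover have "infinite (range (\<lambda>y::complex. [:y:]))"
    by (subst finite_image_iff) (auto simp: inj_on_def infinite_UNIV_char_0)
  ultimately show False
    using finite_subset by blast
qed

lemma poly_cheb_cos: "poly (cheb n) (cos t) = cos (of_nat n * t)" for t :: complex
proof (induction n rule: cheb.induct)
  case (3 n)
  have "cos (of_nat (Suc (Suc n)) * t) + cos (of_nat n * t) = 2 * cos (of_nat (Suc n) * t) * cos t"
    using cos_times_cos[of "of_nat (Suc n) * t" t] by (simp add: algebra_simps)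
  with 3 show ?case by (simp add: algebra_simps)
qed simp_all

lemma poly_cheb_varX: "poly (cheb n) varX = [:cheb n:]"
  by (induction n rule: cheb.induct) (simp_all add: varX_def numeral_poly one_pCons algebra_simps)

lemma poly_cheb_varY: "poly (cheb n) varY = cheb n"
  by (induction n rule: cheb.induct) (simp_all add: varY_def numeral_poly one_pCons algebra_simps)

text \<open>In the recursion the term 2t T_{n+1} has larger degree than T_n, and characteristic 0
  keeps the factor 2 from vanishing. Truncated subtraction makes the exponent right for n = 0 as
  well. The type class admits \<open>complex poly\<close> as coefficient ring, where the degree is
  the degree in y.\<close>

lemma degree_cheb_aux:
  "degree (cheb n :: 'a::{idom, ring_char_0} poly) = n \<and>
   lead_coeff (cheb n :: 'a poly) = 2 ^ (n - 1)"
proof (induction n rule: cheb.induct)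
  case (3 n)
  let ?p = "[:0, 2:] * cheb (Suc n) :: 'a poly"
  have ne: "(cheb (Suc n) :: 'a poly) \<noteq> 0"
    using 3(1) by auto
  then have deg: "degree ?p = Suc (Suc n)"
    using 3 by (subst degree_mult_eq) auto
  moreover have "lead_coeff ?p = 2 ^ Suc n"
    using 3 by (subst lead_coeff_mult) auto
  moreover have "degree (cheb n :: 'a poly) < degree ?p"
    using 3 deg by simp
  ultimately show ?case
    using 3 degree_add_eq_left[of "- cheb n" ?p] by (simp add: coeff_eq_0)
qed simp_all

lemma degree_cheb [simp]: "degree (cheb n :: 'a::{idom, ring_char_0} poly) = n"
  using degree_cheb_aux by blast

lemma coeff_cheb [simp]: "coeff (cheb n :: 'a::{idom, ring_char_0} poly) n = 2 ^ (n - 1)"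
  using degree_cheb_aux by metis

section \<open>Irreducibility criterion for parametrized curves\<close>

lemma eval2_conv_poly: "eval2 P x y = poly (map_poly (\<lambda>c. poly c x) P) y"
  by (induction P) (simp_all add: eval2_def map_poly_pCons)

lemma holomorphic_eval2:
  assumes "f holomorphic_on A" "g holomorphic_on A"
  shows "(\<lambda>t. eval2 P (f t) (g t)) holomorphic_on A"
proof (induction P)
  case (pCons c P)
  have "(\<lambda>t. poly c (f t)) holomorphic_on A"
    by (induction c) (auto intro!: holomorphic_intros assms)
  moreover have "eval2 (pCons c P) x y = poly c x + y * eval2 P x y" for x y
    by (simp add: eval2_def)
  ultimately show ?case
    by (auto intro!: holomorphic_intros assms pCons)
qed (simp add: eval2_def)

text \<open>If g is not identically 0, it is nonzero on a nonempty open set; f vanishes there, hence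
  everywhere by analytic continuation.\<close>

lemma holomorphic_mult_eq_0:
  assumes "f holomorphic_on UNIV" "g holomorphic_on UNIV" "\<And>t. f t * g t = 0"
  shows "(\<forall>t. f t = 0) \<or> (\<forall>t. g t = 0)"
proof (rule disjCI)
  assume "\<not> (\<forall>t. g t = 0)"
  then obtain t0 where "g t0 \<noteq> 0" by blast
  moreover have "open {t. g t \<noteq> 0}"
    using assms(2) by (intro open_Collect_neq) (auto intro: holomorphic_on_imp_continuous_on)
  ultimately show "\<forall>t. f t = 0"
    using analytic_continuation_open[of "{t. g t \<noteq> 0}" UNIV f "\<lambda>_. 0"] assms by auto
qed

text \<open>The set S consists of y-coordinates of curve points above x = \<open>\<xi>\<close>,
  enough of them to exhaust the degree in y. The unit leading coefficient serves twice: a factor of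
  P cannot become 0 when x is fixed, and a cofactor of degree 0 in y is a unit.\<close>

lemma irreducible_if_vanishes_on_curve:
  assumes deg: "degree P > 0" and unit: "lead_coeff P dvd 1"
    and hol: "f holomorphic_on UNIV" "g holomorphic_on UNIV"
    and zero: "\<And>t. eval2 P (f t) (g t) = 0"
    and S: "S \<subseteq> g ` {t. f t = \<xi>}" "card S \<ge> degree P"
  shows "irreducible P"
proof (rule irreducibleI)
  show "P \<noteq> 0" using deg by auto
  show "\<not> P dvd 1" using deg by (auto simp: is_unit_poly_iff)
  have *: "G dvd 1" if PFG: "P = F * G" and F: "\<And>t. eval2 F (f t) (g t) = 0" for F G
  proof -
    have FG: "F \<noteq> 0" "G \<noteq> 0" using deg PFG by auto
    have lc: "lead_coeff P = lead_coeff F * lead_coeff G"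
      by (simp add: PFG lead_coeff_mult)
    have "lead_coeff F dvd 1" using unit lc by (metis dvd_mult_left)
    then obtain c where c: "lead_coeff F = [:c:]" "c \<noteq> 0"
      by (auto elim!: is_unit_polyE simp: dvd_field_iff)
    \<comment> \<open>Specializing x to \<open>\<xi>\<close> keeps the leading coefficient, which is
      the nonzero constant c; so \<open>Fx\<close> is nonzero and has at most
      \<open>degree F\<close> roots, among them all of S.\<close>
    define Fx where "Fx = map_poly (\<lambda>c. poly c \<xi>) F"
    have "coeff Fx (degree F) = c" by (simp add: Fx_def coeff_map_poly c)
    then have Fx: "Fx \<noteq> 0" using c by auto
    have "S \<subseteq> {y. poly Fx y = 0}"
      using S(1) F by (auto simp: Fx_def eval2_conv_poly[symmetric])
    then have "card S \<le> card {y. poly Fx y = 0}"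
      by (intro card_mono poly_roots_finite Fx)
    also have "\<dots> \<le> degree Fx" using Fx by (rule card_poly_roots_bound)
    also have "\<dots> \<le> degree F" unfolding Fx_def by (rule map_poly_degree_leq)
    finally have "degree G = 0"
      using S(2) FG by (simp add: PFG degree_mult_eq)
    then obtain r where r: "G = [:r:]" by (rule degree_eq_zeroE)
    have "r dvd 1" using unit lc r by (metis dvd_mult_right lead_coeff_pCons(2))
    then show ?thesis by (simp add: r is_unit_const_poly_iff)
  qed
  fix F G assume PFG: "P = F * G"
  have "(\<forall>t. eval2 F (f t) (g t) = 0) \<or> (\<forall>t. eval2 G (f t) (g t) = 0)"
    using zero by (intro holomorphic_mult_eq_0 holomorphic_eval2 hol) (simp add: PFG)
  then show "F dvd 1 \<or> G dvd 1"
    using *[of F G] *[of G F] PFG by (auto simp: mult.commute)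
qed

section \<open>Product formula for a difference of cosines\<close>

text \<open>Multiplication by c permutes the residues modulo d, so the usual enumeration of the
  roots of unity is only reordered.\<close>

lemma bij_betw_roots_unity_coprime:
  assumes "d > 0" "coprime c d"
  shows "bij_betw (\<lambda>k. cis (2 * real c * real k * pi / real d)) {..<d} {z. z ^ d = 1}"
proof -
  have "inj_on (\<lambda>k. c * k mod d) {..<d}"
    using assms cong_less_modulus_unique_nat cong_mult_lcancel_nat
    unfolding inj_on_def cong_def[symmetric] by blast
  moreover have "(\<lambda>k. c * k mod d) ` {..<d} \<subseteq> {..<d}"
    using assms by auto
  ultimately have "bij_betw (\<lambda>k. c * k mod d) {..<d} {..<d}"
    by (simp add: bij_betw_def endo_inj_surj)
  from bij_betw_trans[OF this Complex.bij_betw_roots_unity[OF assms(1)]]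
  have "bij_betw ((\<lambda>k. cis (2 * pi * real k / real d)) \<circ> (\<lambda>k. c * k mod d)) {..<d} {z. z ^ d = 1}" .
  moreover have "cis (2 * pi * real (c * k mod d) / real d) = cis (2 * real c * real k * pi / real d)" for k
  proof -
    \<comment> \<open>Replacing c k by its residue modulo d changes the angle by a multiple of 2
      pi.\<close>
    have "real c * real k = real (c * k mod d) + real d * real (c * k div d)"
      by (metis mod_mult_div_eq of_nat_add of_nat_mult)
    then have "2 * pi * (real c * real k) / real d =
        2 * pi * real (c * k mod d) / real d + 2 * pi * real (c * k div d)"
      using assms(1) by (simp only:) (simp add: field_simps)
    moreover have "2 * real c * real k * pi / real d = 2 * pi * (real c * real k) / real d"
      by simp
    ultimately show ?thesis
      by (simp only: cis_mult[symmetric]) (simp add: cis_multiple_2pi)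
  qed
  ultimately show ?thesis by (simp add: comp_def)
qed

text \<open>As polynomials in z both sides are monic of degree d and vanish at the points w \<zeta>;
  these are d distinct points because w is nonzero.\<close>

lemma prod_minus_roots_unity:
  fixes z w :: complex
  assumes "d > 0" "w \<noteq> 0"
  shows "(\<Prod>\<zeta>\<in>{\<zeta>. \<zeta> ^ d = 1}. z - w * \<zeta>) = z ^ d - w ^ d"
proof -
  let ?R = "{\<zeta>::complex. \<zeta> ^ d = 1}"
  define p :: "complex poly" where "p = (\<Prod>\<zeta>\<in>?R. [:- (w * \<zeta>), 1:])"
  define q :: "complex poly" where "q = monom 1 d - [:w ^ d:]"
  have fin: "finite ?R" and card: "card ?R = d"
    using assms by (auto simp: finite_roots_unity card_roots_unity_eq)
  have "p = q"
  proof (rule poly_eqI_degree_lead_coeff[where n = d and A = "(\<lambda>\<zeta>. w * \<zeta>) ` ?R"])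
    have "degree p = d"
      unfolding p_def by (subst degree_prod_eq_sum_degree) (simp_all add: card)
    moreover have "lead_coeff p = 1"
      unfolding p_def by (subst lead_coeff_prod) simp
    ultimately show "degree p \<le> d" "coeff p d = coeff q d"
      using assms(1) by (simp_all add: q_def coeff_pCons split: nat.split)
    show "degree q \<le> d"
      unfolding q_def by (intro degree_diff_le degree_monom_le) simp
    show "card ((\<lambda>\<zeta>. w * \<zeta>) ` ?R) \<ge> d"
      using assms(2) card by (subst card_image) (auto simp: inj_on_def)
    show "poly p x = poly q x" if "x \<in> (\<lambda>\<zeta>. w * \<zeta>) ` ?R" for x
      using that fin by (auto simp: p_def q_def poly_prod poly_monom power_mult_distrib prod_zero_iff)
  qed
  then have "poly p z = poly q z" by simp
  then show ?thesis by (simp add: p_def q_def poly_prod poly_monom)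
qed

text \<open>With z = exp(i \<alpha>) and v = exp(i \<gamma>), cos \<alpha> - cos \<gamma> = (z -
  v)(z - 1/v) / (2z). Taking v = w \<zeta> and multiplying over all d-th roots of unity \<zeta>
  replaces z and w by their d-th powers, which gives the same expression for the angles d \<alpha>
  and d \<beta> up to the power of 2.\<close>

lemma prod_cos_minus_cos:
  fixes \<alpha> \<beta> :: complex
  assumes "d > 0" "coprime c d"
  shows "cos (of_nat d * \<alpha>) - cos (of_nat d * \<beta>) =
    2 ^ (d - 1) * (\<Prod>k<d. cos \<alpha> - cos (\<beta> + of_real (2 * real c * real k * pi / real d)))"
proof -
  define z w where "z = exp (\<i> * \<alpha>)" and "w = exp (\<i> * \<beta>)"
  have z: "z \<noteq> 0" and w: "w \<noteq> 0" by (simp_all add: z_def w_def)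
  let ?R = "{\<zeta>::complex. \<zeta> ^ d = 1}"
  define h where "h = (\<lambda>\<zeta>. (z - w * \<zeta>) * (z - inverse w * inverse \<zeta>) / (2 * z))"
  have factor: "cos \<alpha> - cos (\<beta> + of_real x) = h (cis x)" for x
  proof -
    have "exp (\<i> * (\<beta> + of_real x)) = w * cis x"
      by (simp add: w_def exp_add cis_conv_exp distrib_left)
    moreover have "exp (- (\<i> * (\<beta> + of_real x))) = inverse w * inverse (cis x)"
      by (simp add: w_def cis_conv_exp distrib_left flip: exp_minus exp_add)
    ultimately show ?thesis
      using z w by (simp add: h_def cos_exp_eq exp_minus z_def[symmetric]) (simp add: field_simps cis_mult)
  qed
  \<comment> \<open>The second factor of h contains the inverse of \<zeta>; reindexing by inversion
    lets \<open>prod_minus_roots_unity\<close> apply to it with the inverse of w.\<close>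
  have inv: "bij_betw inverse ?R ?R"
    by (rule bij_betwI[of _ _ _ inverse]) (auto simp: power_inverse)
  have "(\<Prod>k<d. cos \<alpha> - cos (\<beta> + of_real (2 * real c * real k * pi / real d))) = (\<Prod>\<zeta>\<in>?R. h \<zeta>)"
    unfolding factor by (rule prod.reindex_bij_betw[OF bij_betw_roots_unity_coprime[OF assms]])
  also have "\<dots> = (z ^ d - w ^ d) * (z ^ d - inverse w ^ d) / (2 * z) ^ d"
    using prod.reindex_bij_betw[OF inv, of "\<lambda>\<zeta>. z - inverse w * \<zeta>"] assms w
    by (simp add: h_def prod_dividef prod.distrib prod_minus_roots_unity card_roots_unity_eq)
  also have "2 ^ (d - 1) * \<dots> = ((z ^ d + inverse (z ^ d)) - (w ^ d + inverse (w ^ d))) / 2"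
  proof -
    \<comment> \<open>The denominator contributes 2^d, so one factor 1/2 is left over; it is the one
      in cos = (exp + 1/exp) / 2.\<close>
    have "2 ^ d = 2 * (2::complex) ^ (d - 1)"
      using assms(1) by (metis power_eq_if neq0_conv)
    then show ?thesis
      using z w by (simp add: power_mult_distrib power_inverse field_simps)
  qed
  also have "\<dots> = cos (of_nat d * \<alpha>) - cos (of_nat d * \<beta>)"
    unfolding cos_exp_eq z_def w_def exp_of_nat_mult[symmetric]
    by (simp add: exp_minus mult.left_commute diff_divide_distrib)
  finally show ?thesis by simp
qed

text \<open>The reflection k to d - k carries the indices below d/2, other than 0, onto those above.
  The index 0 and, for even d, the index d/2 have no partner; these will be the linear factors,
  while the pairs become quadratic ones.\<close>

lemma prod_pair_reflect:
  fixes f g :: "nat \<Rightarrow> 'a::comm_monoid_mult"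
  assumes d: "d > 0" and f0: "g 0 = f 0"
    and mid: "\<And>k. 2 * k = d \<Longrightarrow> g k = f k"
    and pair: "\<And>k. 0 < k \<Longrightarrow> 2 * k < d \<Longrightarrow> g k = f k * f (d - k)"
  shows "(\<Prod>k<d. f k) = (\<Prod>k=0..d div 2. g k)"
proof -
  define A B C where "A = {k. 0 < k \<and> 2 * k < d}" and "B = {k. 2 * k = d}"
    and "C = {k. k < d \<and> d < 2 * k}"
  have fin: "finite A" "finite B" "finite C"
    by (rule finite_subset[of _ "{..d}"]; auto simp: A_def B_def C_def)+
  have "{..<d} = insert 0 (A \<union> B \<union> C)" "{0..d div 2} = insert 0 (A \<union> B)"
    using d by (auto simp: A_def B_def C_def)
  moreover have "0 \<notin> A \<union> B \<union> C" "0 \<notin> A \<union> B" "A \<inter> B = {}" "(A \<union> B) \<inter> C = {}"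
    using d by (auto simp: A_def B_def C_def)
  moreover have "prod f C = (\<Prod>k\<in>A. f (d - k))"
    by (rule prod.reindex_bij_witness[of _ "\<lambda>k. d - k" "\<lambda>k. d - k"]) (auto simp: A_def C_def)
  moreover have "prod g A = (\<Prod>k\<in>A. f k * f (d - k))" "prod g B = prod f B"
    by (rule prod.cong; auto simp: A_def B_def pair mid)+
  ultimately show ?thesis
    using fin f0 by (simp only: prod.insert finite_UnI not_False_eq_True prod.union_disjoint
        prod.distrib mult.assoc mult.commute mult.left_commute)
qed

section \<open>The factors E in trigonometric form and their zero sets\<close>

text \<open>By the addition formulas the left side is a difference of squares, with cos \<beta> -
  cos \<alpha> cos \<mu> and sin \<alpha> sin \<mu>. The right side is the generic form of
  \<open>E\<close>.\<close>

lemma cos_plus_minus_product: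
  fixes \<alpha> \<beta> \<mu> :: "'a::{real_normed_field, banach}"
  shows "(cos \<beta> - cos (\<alpha> + \<mu>)) * (cos \<beta> - cos (\<alpha> - \<mu>)) =
    (cos \<alpha>)\<^sup>2 + (cos \<beta>)\<^sup>2 - 2 * cos \<mu> * cos \<alpha> * cos \<beta> - (sin \<mu>)\<^sup>2"
proof -
  have "(cos \<beta> - cos (\<alpha> + \<mu>)) * (cos \<beta> - cos (\<alpha> - \<mu>)) =
      (cos \<beta> - cos \<alpha> * cos \<mu>)\<^sup>2 - (sin \<alpha>)\<^sup>2 * (sin \<mu>)\<^sup>2"
    unfolding cos_add cos_diff by (simp add: algebra_simps power2_eq_square)
  also have "\<dots> = (cos \<beta>)\<^sup>2 - 2 * cos \<mu> * cos \<alpha> * cos \<beta>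
      + (cos \<alpha>)\<^sup>2 * (cos \<mu>)\<^sup>2 - (sin \<alpha>)\<^sup>2 * (sin \<mu>)\<^sup>2"
    by (simp add: algebra_simps power2_eq_square)
  also have "\<dots> = (cos \<alpha>)\<^sup>2 + (cos \<beta>)\<^sup>2 - 2 * cos \<mu> * cos \<alpha> * cos \<beta> - (sin \<mu>)\<^sup>2"
    by (simp add: sin_squared_eq[of \<alpha>] cos_squared_eq[of \<mu>] algebra_simps)
  finally show ?thesis .
qed

lemma rcong_0_2pi_iff: "[\<mu> = 0] (rmod (2 * pi)) \<longleftrightarrow> (\<exists>n. \<mu> = 2 * of_int n * pi)"
proof -
  have "[\<mu> = 0] (rmod (2 * pi)) \<longleftrightarrow> [0 = \<mu>] (rmod (2 * pi))"
    by (rule rcong_sym_iff)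
  then show ?thesis by (simp add: rcong_altdef mult_ac)
qed

lemma rcong_pi_2pi_iff: "[\<mu> = pi] (rmod (2 * pi)) \<longleftrightarrow> (\<exists>n. \<mu> = (2 * of_int n + 1) * pi)"
proof -
  have "[\<mu> = pi] (rmod (2 * pi)) \<longleftrightarrow> [pi = \<mu>] (rmod (2 * pi))"
    by (rule rcong_sym_iff)
  then show ?thesis by (simp add: rcong_altdef algebra_simps)
qed

text \<open>The two linear cases in the definition of \<open>E\<close> are thus detected together by
  a single condition.\<close>

lemma sin_zero_iff_rcong:
  "sin \<mu> = 0 \<longleftrightarrow> [\<mu> = 0] (rmod (2 * pi)) \<or> [\<mu> = pi] (rmod (2 * pi))"
proof -
  have "(\<exists>i::int. \<mu> = of_int i * pi) \<longleftrightarrow>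
      (\<exists>n::int. \<mu> = of_int (2 * n) * pi) \<or> (\<exists>n::int. \<mu> = of_int (2 * n + 1) * pi)"
    by (metis evenE oddE)
  then show ?thesis
    unfolding rcong_0_2pi_iff rcong_pi_2pi_iff sin_zero_iff_int2 by simp
qed

lemma cos_add_rcong_0:
  fixes \<alpha> :: complex
  assumes "[\<mu> = 0] (rmod (2 * pi))"
  shows "cos (\<alpha> + of_real \<mu>) = cos \<alpha>" "cos (\<alpha> - of_real \<mu>) = cos \<alpha>"
proof -
  obtain n where "\<mu> = 2 * pi * of_int n"
    using assms unfolding rcong_0_2pi_iff by (auto simp: mult_ac)
  then have "cos \<mu> = 1" "sin \<mu> = 0" by (simp_all only: cos_int_2pin sin_int_2pin)
  then show "cos (\<alpha> + of_real \<mu>) = cos \<alpha>" "cos (\<alpha> - of_real \<mu>) = cos \<alpha>"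
    by (simp_all add: cos_add cos_diff cos_of_real sin_of_real)
qed

lemma cos_add_rcong_pi:
  fixes \<alpha> :: complex
  assumes "[\<mu> = pi] (rmod (2 * pi))"
  shows "cos (\<alpha> + of_real \<mu>) = - cos \<alpha>" "cos (\<alpha> - of_real \<mu>) = - cos \<alpha>"
proof -
  have "[\<mu> - pi = 0] (rmod (2 * pi))"
    using rcong_diff[OF assms rcong_refl[of pi]] by simp
  from cos_add_rcong_0[OF this, of "\<alpha> + of_real pi"] cos_add_rcong_0[OF this, of "\<alpha> - of_real pi"]
  show "cos (\<alpha> + of_real \<mu>) = - cos \<alpha>" "cos (\<alpha> - of_real \<mu>) = - cos \<alpha>"
    by (simp_all add: cos_add cos_diff cos_of_real sin_of_real)
qed

text \<open>The generic form of \<open>E\<close> is symmetric in its two arguments, so the shift may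
  be put on either angle: the first version serves the zero set, the second the
  factorization.\<close>

lemma eval2_E_generic:
  assumes "sin \<mu> \<noteq> 0" and "eval2 p x y = cos \<alpha>" and "eval2 q x y = cos \<beta>"
  shows "eval2 (E \<mu> p q) x y = (cos \<beta> - cos (\<alpha> + of_real \<mu>)) * (cos \<beta> - cos (\<alpha> - of_real \<mu>))"
    and "eval2 (E \<mu> p q) x y = (cos \<alpha> - cos (\<beta> + of_real \<mu>)) * (cos \<alpha> - cos (\<beta> - of_real \<mu>))"
  using assms
  by (simp_all add: E_def sin_zero_iff_rcong cos_plus_minus_product cos_of_real[symmetric] sin_of_real[symmetric])

text \<open>For sin \<mu> = 0 the two alternatives coincide and give the linear equation of that
  case, so the three forms of \<open>E\<close> share one description of their zeros.\<close>

lemma eval2_E_eq_0_iff: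
  assumes "eval2 p x y = cos \<alpha>" and "eval2 q x y = cos \<beta>"
  shows "eval2 (E \<mu> p q) x y = 0 \<longleftrightarrow>
    cos \<beta> = cos (\<alpha> + of_real \<mu>) \<or> cos \<beta> = cos (\<alpha> - of_real \<mu>)"
proof (cases "sin \<mu> = 0")
  case True
  then consider (zero) "[\<mu> = 0] (rmod (2 * pi))"
    | (pi) "\<not> [\<mu> = 0] (rmod (2 * pi))" "[\<mu> = pi] (rmod (2 * pi))"
    unfolding sin_zero_iff_rcong by blast
  then show ?thesis
  proof cases
    case zero
    then show ?thesis using assms by (auto simp: E_def cos_add_rcong_0)
  next
    case pi
    then show ?thesis
      using assms by (simp add: E_def cos_add_rcong_pi eq_neg_iff_add_eq_0 add.commute)
  qed
qed (use eval2_E_generic(1)[OF _ assms] in simp)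

lemma E_vanishes_on_curve_iff:
  assumes "a > 0" "coprime a b"
  shows "{(x, y). eval2 (E (real a * \<phi>) (poly (cheb b) varX) (poly (cheb a) varY)) x y = 0} =
    curve a b \<phi>" (is "?Z = _")
proof (intro equalityI subsetI)
  fix p assume "p \<in> curve a b \<phi>"
  then obtain t where p: "p = (cos (of_nat a * t), cos (of_nat b * t + of_real \<phi>))"
    by (auto simp: curve_def)
  \<comment> \<open>This makes T_a(y) = cos(b (a t) + a \<phi>), the first alternative in
    \<open>eval2_E_eq_0_iff\<close>.\<close>
  have "of_nat a * (of_nat b * t + of_real \<phi>) = of_nat b * (of_nat a * t) + of_real (real a * \<phi>)"
    by (simp add: algebra_simps)
  then show "p \<in> ?Z"
    unfolding p by (simp add: eval2_E_eq_0_iff[OF trans[OF eval2_cheb] trans[OF eval2_cheb]] poly_cheb_cos)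
next
  fix p assume "p \<in> ?Z"
  then obtain x y where p: "p = (x, y)"
    and Z: "eval2 (E (real a * \<phi>) (poly (cheb b) varX) (poly (cheb a) varY)) x y = 0"
    by auto
  define u v where "u = Arccos x" and "v = Arccos y"
  have uv: "x = cos u" "y = cos v" by (simp_all add: u_def v_def)
  have "cos (of_nat a * v) = cos (of_nat b * u + of_real (real a * \<phi>)) \<or>
      cos (of_nat a * v) = cos (of_nat b * u - of_real (real a * \<phi>))"
    using Z uv by (subst (asm) eval2_E_eq_0_iff[where \<alpha> = "of_nat b * u" and \<beta> = "of_nat a * v"])
      (auto simp: poly_cheb_cos)
  \<comment> \<open>Since cos is even, u may be replaced by -u without changing x; this turns the
    alternative with -\<mu> into the one with +\<mu>.\<close>
  moreover have "cos (of_nat b * u - of_real (real a * \<phi>)) = cos (of_nat b * (- u) + of_real (real a * \<phi>))"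
    by (metis (no_types, opaque_lifting) cos_minus minus_diff_eq mult_minus_right uminus_add_conv_diff add.commute)
  ultimately obtain u' where u': "x = cos u'" "cos (of_nat a * v) = cos (of_nat b * u' + of_real (real a * \<phi>))"
    using uv by (metis cos_minus)
  then obtain n where "n \<in> \<int>" and n:
    "of_nat a * v = of_nat b * u' + of_real (real a * \<phi>) + of_real (2 * n * pi) \<or>
     of_nat a * v = - (of_nat b * u' + of_real (real a * \<phi>)) + of_real (2 * n * pi)"
    unfolding complex_cos_eq by blast
  \<comment> \<open>The sign ambiguity of the second angle is removed in the same way, by passing
    from v to -v.\<close>
  have "\<exists>v' n. y = cos v' \<and>
      of_nat a * v' = of_nat b * u' + of_real (real a * \<phi>) + of_real (2 * of_int n * pi)"
    using n
  proof
    assume *: "of_nat a * v = of_nat b * u' + of_real (real a * \<phi>) + of_real (2 * n * pi)"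
    then show ?thesis using uv \<open>n \<in> \<int>\<close> by (auto elim!: Ints_cases)
  next
    assume *: "of_nat a * v = - (of_nat b * u' + of_real (real a * \<phi>)) + of_real (2 * n * pi)"
    then have "of_nat a * (- v) = of_nat b * u' + of_real (real a * \<phi>) + of_real (2 * (- n) * pi)"
      by simp
    moreover have "y = cos (- v)" "- n \<in> \<int>" using uv \<open>n \<in> \<int>\<close> by auto
    ultimately show ?thesis by (metis Ints_cases)
  qed
  then obtain v' n where v': "y = cos v'"
    and eq: "of_nat a * v' = of_nat b * u' + of_real (real a * \<phi>) + of_real (2 * of_int n * pi)"
    by blast
  have "coprime (int a) (int b)" using assms by simp
  \<comment> \<open>Bezout splits the n periods into j a + i b: the part i b is absorbed by shifting
    u' by i periods, the part j a by shifting v' by j periods.\<close>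
  then obtain r s where "r * int a + s * int b = 1"
    by (metis bezout_int coprime_iff_gcd_eq_1)
  then have "n = (r * n) * int a + (s * n) * int b"
    by (metis distrib_right mult.assoc mult.commute mult_1)
  then obtain i j where ij: "n = j * int a + i * int b" by blast
  \<comment> \<open>The equation a t = u' + 2 pi i, with i the integer above, gives the right x; the
    next computation shows that b t + \<phi> then differs from v' by j full periods.\<close>
  define t where "t = (u' + of_real (2 * of_int i * pi)) / of_nat a"
  have "cos (of_nat a * t) = x"
    using assms unfolding t_def u' by (auto simp: complex_cos_eq intro!: bexI[of _ "of_int i"])
  moreover have "of_nat b * t + of_real \<phi> = v' - of_real (2 * of_int j * pi)"
  proof -
    have at: "of_nat a * t = u' + of_real (2 * of_int i * pi)"
      using assms by (simp add: t_def)
    have "of_nat a * (of_nat b * t + of_real \<phi>) = of_nat b * (of_nat a * t) + of_nat a * of_real \<phi>"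
      by (simp add: algebra_simps)
    also have "\<dots> = of_nat a * v' - of_nat a * of_real (2 * of_int j * pi)"
      unfolding eq ij at by (simp add: algebra_simps)
    finally have "of_nat a * (of_nat b * t + of_real \<phi>) = of_nat a * (v' - of_real (2 * of_int j * pi))"
      by (simp only: right_diff_distrib)
    then show ?thesis using assms by simp
  qed
  then have "cos (of_nat b * t + of_real \<phi>) = y"
    unfolding v' complex_cos_eq by (auto intro!: bexI[of _ "- of_int j"])
  ultimately show "p \<in> curve a b \<phi>" unfolding p curve_def by (intro CollectI exI[of _ t]) simp
qed

section \<open>Irreducibility of the factors\<close>

text \<open>The outer variable is y, so the leading coefficient is a polynomial in x. It comes from
  T_a(y) or its square alone, and hence is a power of 2 up to sign, a unit.\<close>

lemma degree_E_cheb: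
  fixes a b :: nat and \<mu> :: real
  assumes "a > 0"
  defines "P \<equiv> E \<mu> (poly (cheb b) varX) (poly (cheb a) varY)"
  shows "degree P = (if sin \<mu> = 0 then a else 2 * a)" "lead_coeff P dvd 1"
proof -
  have unit: "(2::complex poly) ^ k dvd 1" for k
    by (simp add: is_unit_power_iff numeral_poly is_unit_const_poly_iff dvd_field_iff)
  have "degree P = (if sin \<mu> = 0 then a else 2 * a) \<and> lead_coeff P dvd 1"
  proof (cases "sin \<mu> = 0")
    case True
    have P: "P = [:cheb b:] - cheb a \<or> P = [:cheb b:] + cheb a"
      using True by (auto simp: P_def E_def sin_zero_iff_rcong poly_cheb_varX poly_cheb_varY)
    have "degree ([:cheb b:] - cheb a :: complex poly poly) = a"
      using assms degree_add_eq_right[of "[:cheb b:]" "- cheb a :: complex poly poly"] by simp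
    moreover have "degree ([:cheb b:] + cheb a :: complex poly poly) = a"
      using assms degree_add_eq_right[of "[:cheb b:]" "cheb a :: complex poly poly"] by simp
    ultimately have deg: "degree P = a" using P by auto
    have "coeff [:cheb b :: complex poly:] a = 0"
      using assms by (simp add: coeff_pCons split: nat.split)
    then have "coeff P a = - (2 ^ (a - 1)) \<or> coeff P a = 2 ^ (a - 1)"
      using P by auto
    then have "coeff P a dvd 1" using unit[of "a - 1"] by (metis minus_dvd_iff)
    then show ?thesis using True deg by simp
  next
    case False
    define c where "c = [:complex_of_real (2 * cos \<mu>):] * cheb b"
    \<comment> \<open>\<open>Q\<close> collects everything of degree at most a in y, which is below
      2a because a > 0.\<close>
    define Q where "Q = [:(cheb b)\<^sup>2 - [:of_real ((sin \<mu>)\<^sup>2):]:] - smult c (cheb a)"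
    have P: "P = Q + (cheb a)\<^sup>2"
      using False by (simp add: P_def Q_def c_def E_def sin_zero_iff_rcong poly_cheb_varX poly_cheb_varY
        const2_def power2_eq_square algebra_simps)
    have "degree (smult c (cheb a)) \<le> a" by (metis degree_smult_le degree_cheb)
    then have "degree Q \<le> a" unfolding Q_def by (intro degree_diff_le) simp_all
    then have less: "degree Q < 2 * a" using assms by simp
    have "(cheb a :: complex poly poly) \<noteq> 0"
      using assms by (metis degree_0 degree_cheb less_irrefl)
    then have sq: "degree ((cheb a :: complex poly poly)\<^sup>2) = 2 * a"
      by (simp add: degree_power_eq)
    then have sq': "coeff ((cheb a :: complex poly poly)\<^sup>2) (2 * a) = (2 ^ (a - 1))\<^sup>2"
      using lead_coeff_power[of "cheb a :: complex poly poly" 2] by simp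
    have "degree P = 2 * a" unfolding P using degree_add_eq_right[of Q "(cheb a)\<^sup>2"] less sq by simp
    moreover from this have "lead_coeff P = (2 ^ (a - 1))\<^sup>2"
      using sq' less by (simp add: P coeff_eq_0)
    ultimately show ?thesis using False unit[of "(a - 1) * 2"] by (simp only: power_mult if_False)
  qed
  then show "degree P = (if sin \<mu> = 0 then a else 2 * a)" "lead_coeff P dvd 1" by auto
qed

lemma irreducible_E_cheb:
  assumes a: "a > 0" and b: "b > 0" and cop: "coprime a b"
  shows "irreducible (E (real a * \<phi>) (poly (cheb b) varX) (poly (cheb a) varY))"
proof -
  \<comment> \<open>The solutions of cos(a t) = cos i are a t = e i + 2 pi j with e = 1 or e = -1.
    All 2a of them modulo 2 pi are needed when \<open>E\<close> is quadratic; when it is linear, e =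
    1 already gives the required a points. The imaginary value i is chosen so that imaginary parts
    tell the two signs apart.\<close>
  define D :: "real set" where "D = (if sin (real a * \<phi>) = 0 then {1} else {1, -1})"
  define \<tau> :: "real \<times> nat \<Rightarrow> complex"
    where "\<tau> = (\<lambda>(e, j). (of_real e * \<i> + of_real (2 * real j * pi)) / of_nat a)"
  define g :: "complex \<Rightarrow> complex" where "g = (\<lambda>t. cos (of_nat b * t + of_real \<phi>))"
  have Re: "Re (of_nat b * \<tau> (e, j) + of_real \<phi>) = 2 * pi * real b * real j / real a + \<phi>"
    and Im: "Im (of_nat b * \<tau> (e, j) + of_real \<phi>) = real b * e / real a" for e j
    by (simp_all add: \<tau>_def)
  have "inj_on (g \<circ> \<tau>) (D \<times> {..<a})"
  proof (rule inj_onI, clarify)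
    fix e e' :: real and j j' :: nat
    assume D: "e \<in> D" "e' \<in> D" and j: "j < a" "j' < a" and eq: "(g \<circ> \<tau>) (e, j) = (g \<circ> \<tau>) (e', j')"
    define \<theta> \<theta>' where "\<theta> = of_nat b * \<tau> (e, j) + of_real \<phi>" and "\<theta>' = of_nat b * \<tau> (e', j') + of_real \<phi>"
    note parts = Re[of e j, folded \<theta>_def] Im[of e j, folded \<theta>_def]
      Re[of e' j', folded \<theta>'_def] Im[of e' j', folded \<theta>'_def]
    from eq have "cos \<theta> = cos \<theta>'" by (simp add: g_def \<theta>_def \<theta>'_def)
    then obtain n where n: "\<theta> = \<theta>' + of_real (2 * of_int n * pi) \<or> \<theta> = - \<theta>' + of_real (2 * of_int n * pi)"
      unfolding complex_cos_eq by (metis Ints_cases)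
    then show "e = e' \<and> j = j'"
    proof
      \<comment> \<open>Imaginary parts give e = e'. Real parts give that a divides b (j - j'),
        hence j - j', whose absolute value is less than a.\<close>
      assume *: "\<theta> = \<theta>' + of_real (2 * of_int n * pi)"
      have "e = e'" using arg_cong[OF *, of Im] a b by (simp add: parts)
      have "2 * pi * (real b * real j) = 2 * pi * (real b * real j' + of_int n * real a)"
        using arg_cong[OF *, of Re] a by (simp add: parts field_simps)
      then have "real b * real j = real b * real j' + of_int n * real a" by simp
      then have "int b * int j = int b * int j' + n * int a"
        by (metis (mono_tags) of_int_add of_int_eq_iff of_int_mult of_int_of_nat_eq)
      then have "int a dvd int b * (int j - int j')" by (simp add: algebra_simps)
      then have "int a dvd int j - int j'"
        using cop by (simp add: coprime_dvd_mult_right_iff)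
      moreover have "\<bar>int j - int j'\<bar> < int a" using j by linarith
      ultimately have "j = j'" using dvd_imp_le_int[of "int j - int j'" "int a"] by fastforce
      with \<open>e = e'\<close> show ?thesis by simp
    next
      \<comment> \<open>This case is contradictory: imaginary parts force opposite signs, so D has
        two elements and sin(a \<phi>) is nonzero, whereas real parts make a \<phi> an integer
        multiple of pi.\<close>
      assume *: "\<theta> = - \<theta>' + of_real (2 * of_int n * pi)"
      have "real b * e = real b * (- e')" using arg_cong[OF *, of Im] a by (simp add: parts field_simps)
      then have "e = - e'" using b by (simp only: mult_cancel_left) simp
      then have "sin (real a * \<phi>) \<noteq> 0" using D by (auto simp: D_def split: if_splits)
      moreover have "real a * \<phi> = of_int (n * int a - int b * (int j + int j')) * pi"
        using arg_cong[OF *, of Re] a by (simp add: parts field_simps)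
      ultimately show ?thesis unfolding sin_zero_iff_int2 by blast
    qed
  qed
  then have "card ((g \<circ> \<tau>) ` (D \<times> {..<a})) = card D * a"
    by (simp only: card_image card_cartesian_product card_lessThan)
  then have "card ((g \<circ> \<tau>) ` (D \<times> {..<a})) = (if sin (real a * \<phi>) = 0 then a else 2 * a)"
    by (simp only: D_def split: if_split) simp
  moreover have "(g \<circ> \<tau>) ` (D \<times> {..<a}) \<subseteq> g ` {t. cos (of_nat a * t) = cos \<i>}"
  proof -
    have "cos (of_nat a * \<tau> (e, j)) = cos \<i>" if "e \<in> D" for e j
    proof -
      have "of_nat a * \<tau> (e, j) = of_real e * \<i> + of_real (2 * real j * pi)"
        using a by (simp add: \<tau>_def)
      moreover have "e = 1 \<or> e = -1" using that by (auto simp: D_def split: if_splits)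
      ultimately show ?thesis by (auto simp: complex_cos_eq intro!: bexI[of _ "real j"])
    qed
    then show ?thesis by auto
  qed
  moreover have "eval2 (E (real a * \<phi>) (poly (cheb b) varX) (poly (cheb a) varY))
      (cos (of_nat a * t)) (g t) = 0" for t
    using E_vanishes_on_curve_iff[OF a cop, of \<phi>] unfolding curve_def g_def by blast
  moreover have "(\<lambda>t. cos (of_nat a * t)) holomorphic_on UNIV" "g holomorphic_on UNIV"
    unfolding g_def by (intro holomorphic_intros)+
  ultimately show ?thesis
    by (intro irreducible_if_vanishes_on_curve[OF _ degree_E_cheb(2)[OF a],
        where f = "\<lambda>t. cos (of_nat a * t)" and g = g
        and S = "(g \<circ> \<tau>) ` (D \<times> {..<a})" and \<xi> = "cos \<i>"])
      (simp_all add: degree_E_cheb(1)[OF a] a)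
qed

section \<open>The factorization\<close>

text \<open>The sine vanishes exactly when d divides 2 c k, that is 2 k by coprimality, and 2 k lies
  between 0 and d. So \<open>E\<close> is linear exactly at the indices without a partner under
  reflection.\<close>

lemma sin_2kpi_div_eq_0_iff:
  assumes "d > 0" "coprime c d" "k \<le> d div 2"
  shows "sin (2 * real c * real k * pi / real d) = 0 \<longleftrightarrow> k = 0 \<or> 2 * k = d"
proof
  assume "sin (2 * real c * real k * pi / real d) = 0"
  then obtain i where "2 * real c * real k * pi / real d = of_int i * pi"
    unfolding sin_zero_iff_int2 by blast
  then have "real c * (2 * real k) = of_int i * real d" using assms(1) by (simp add: field_simps)
  then have "int c * (2 * int k) = i * int d"
    by (metis (mono_tags) of_int_eq_iff of_int_mult of_int_of_nat_eq of_int_numeral)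
  then have "int d dvd int c * (2 * int k)" by simp
  then have "int d dvd int (2 * k)"
    using assms(2) by (simp add: coprime_dvd_mult_right_iff coprime_commute)
  then have "d dvd 2 * k" by (simp only: int_dvd_int_iff)
  moreover have "2 * k \<le> d" using assms by simp
  ultimately show "k = 0 \<or> 2 * k = d" using dvd_imp_le[of d "2 * k"] by fastforce
next
  assume "k = 0 \<or> 2 * k = d"
  then show "sin (2 * real c * real k * pi / real d) = 0"
  proof
    assume "2 * k = d"
    then have "2 * real c * real k * pi / real d = real c * pi" using assms(1) by auto
    then show ?thesis by simp
  qed simp
qed

lemma cheb_factorization:
  assumes d: "d > 0" and cop: "coprime c d"
  shows "poly (cheb (b * d)) varX - poly (cheb (a * d)) varY =
    2 ^ (d - 1) * (\<Prod>k = 0..d div 2.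
      E (2 * real c * real k * pi / real d) (poly (cheb b) varX) (poly (cheb a) varY))"
proof (rule eval2_eqI)
  fix x y :: complex
  define u v where "u = Arccos x" and "v = Arccos y"
  define \<alpha> \<beta> where "\<alpha> = of_nat b * u" and "\<beta> = of_nat a * v"
  have x: "x = cos u" and y: "y = cos v" by (simp_all add: u_def v_def)
  define \<mu> where "\<mu> = (\<lambda>k. 2 * real c * real k * pi / real d)"
  define P where "P = (\<lambda>k. E (\<mu> k) (poly (cheb b) varX) (poly (cheb a) varY))"
  define f where "f = (\<lambda>k. cos \<alpha> - cos (\<beta> + of_real (\<mu> k)))"
  have ev: "eval2 (poly (cheb b) varX) x y = cos \<alpha>" "eval2 (poly (cheb a) varY) x y = cos \<beta>"
    by (simp_all add: x y poly_cheb_cos \<alpha>_def \<beta>_def)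
  have "eval2 (poly (cheb (b * d)) varX - poly (cheb (a * d)) varY) x y =
      cos (of_nat d * \<alpha>) - cos (of_nat d * \<beta>)"
    by (simp add: x y poly_cheb_cos \<alpha>_def \<beta>_def mult_ac)
  also have "\<dots> = 2 ^ (d - 1) * (\<Prod>k<d. f k)"
    using prod_cos_minus_cos[OF d cop] by (simp add: f_def \<mu>_def)
  also have "(\<Prod>k<d. f k) = (\<Prod>k=0..d div 2. eval2 (P k) x y)"
  proof (rule prod_pair_reflect[OF d])
    have "[\<mu> 0 = 0] (rmod (2 * pi))" by (simp add: \<mu>_def)
    then show "eval2 (P 0) x y = f 0"
      using ev by (simp add: P_def E_def f_def \<mu>_def)
  next
    fix k assume k: "2 * k = d"
    \<comment> \<open>Here d is even, so coprimality makes c odd and the angle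
      \<open>\<mu> k\<close> = c pi is congruent to pi.\<close>
    then have "odd c" using cop by auto
    then obtain i where "c = 2 * i + 1" by (rule oddE)
    then have "\<mu> k = (2 * of_int (int i) + 1) * pi"
      using k d by (auto simp: \<mu>_def)
    then have pi: "[\<mu> k = pi] (rmod (2 * pi))" unfolding rcong_pi_2pi_iff by blast
    \<comment> \<open>Both congruences together would give cos 0 = - cos 0.\<close>
    then have "\<not> [\<mu> k = 0] (rmod (2 * pi))"
      using cos_add_rcong_0(1)[of "\<mu> k" 0] cos_add_rcong_pi(1)[of "\<mu> k" 0] by auto
    then show "eval2 (P k) x y = f k"
      using pi ev by (simp add: P_def E_def f_def cos_add_rcong_pi)
  next
    fix k assume k: "0 < k" "2 * k < d"
    then have "sin (\<mu> k) \<noteq> 0"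
      unfolding \<mu>_def using sin_2kpi_div_eq_0_iff[OF d cop, of k] by auto
    moreover have "f (d - k) = cos \<alpha> - cos (\<beta> - of_real (\<mu> k))"
    proof -
      \<comment> \<open>The reflected index has the opposite angle modulo 2 pi, so the two factors
        are those of \<open>eval2_E_generic\<close>.\<close>
      have "\<mu> (d - k) = 2 * of_int (int c) * pi - \<mu> k"
        using k by (simp add: \<mu>_def of_nat_diff field_simps)
      moreover have "[2 * of_int (int c) * pi = 0] (rmod (2 * pi))"
        unfolding rcong_0_2pi_iff by blast
      ultimately have "cos ((\<beta> - of_real (\<mu> k)) + of_real (\<mu> (d - k) + \<mu> k)) = cos (\<beta> - of_real (\<mu> k))"
        by (intro cos_add_rcong_0) simp
      then show ?thesis by (simp add: f_def)
    qed
    ultimately show "eval2 (P k) x y = f k * f (d - k)"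
      using eval2_E_generic(2)[OF _ ev] by (simp add: P_def f_def)
  qed
  finally show "eval2 (poly (cheb (b * d)) varX - poly (cheb (a * d)) varY) x y =
    eval2 (2 ^ (d - 1) * (\<Prod>k = 0..d div 2. E (2 * real c * real k * pi / real d)
      (poly (cheb b) varX) (poly (cheb a) varY))) x y"
    by (simp add: P_def \<mu>_def)
qed

text \<open>Both choices of index are instances of the same results: the irreducible equation for
  \<mu> = a \<phi>, and the factorization with c = a or c = 1. Since 1 is coprime to every d, the
  second choice gives a factorization without the condition on a and d.\<close>

theorem theorem8:
  fixes a b d m n :: nat
  assumes "a > 0" and "b > 0" and "d > 0"
    and "coprime a b" and "odd a"
    and "m = a * d" and "n = b * d"
  shows "(\<forall>k \<le> d div 2.
            irreducible_equation_of
              (E (2 * real a * real k * pi / real d) (poly (cheb b) varX) (poly (cheb a) varY))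
              (curve a b (2 * real k * pi / real d)))
       \<and> (coprime a d \<longrightarrow>
            poly (cheb n) varX - poly (cheb m) varY =
              2 ^ (d - 1) * (\<Prod>k = 0..d div 2.
                E (2 * real a * real k * pi / real d) (poly (cheb b) varX) (poly (cheb a) varY)))
       \<and> (\<forall>k \<le> d div 2.
            irreducible_equation_of
              (E (2 * real k * pi / real d) (poly (cheb b) varX) (poly (cheb a) varY))
              (curve a b (2 * real k * pi / (real a * real d))))
       \<and> poly (cheb n) varX - poly (cheb m) varY =
           2 ^ (d - 1) * (\<Prod>k = 0..d div 2.
             E (2 * real k * pi / real d) (poly (cheb b) varX) (poly (cheb a) varY))"
proof -
  have irr: "irreducible_equation_of (E \<mu> (poly (cheb b) varX) (poly (cheb a) varY)) (curve a b \<phi>)"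
    if "\<mu> = real a * \<phi>" for \<mu> \<phi>
    unfolding irreducible_equation_of_def that
    using irreducible_E_cheb E_vanishes_on_curve_iff assms by blast
  have "irreducible_equation_of
      (E (2 * real a * real k * pi / real d) (poly (cheb b) varX) (poly (cheb a) varY))
      (curve a b (2 * real k * pi / real d))" for k
    by (rule irr) simp
  moreover have "irreducible_equation_of
      (E (2 * real k * pi / real d) (poly (cheb b) varX) (poly (cheb a) varY))
      (curve a b (2 * real k * pi / (real a * real d)))" for k
    using assms by (intro irr) simp
  moreover have "poly (cheb n) varX - poly (cheb m) varY =
      2 ^ (d - 1) * (\<Prod>k = 0..d div 2.
        E (2 * real k * pi / real d) (poly (cheb b) varX) (poly (cheb a) varY))"
    using cheb_factorization[of d 1 b a] assms by simp
  moreover have "poly (cheb n) varX - poly (cheb m) varY =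
      2 ^ (d - 1) * (\<Prod>k = 0..d div 2.
        E (2 * real a * real k * pi / real d) (poly (cheb b) varX) (poly (cheb a) varY))"
    if "coprime a d"
    using cheb_factorization[of d a b a] that assms by simp
  ultimately show ?thesis by blast
qed

end
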